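(* Let $\mathcal{E}$ be a Euclidean space, let $\mathcal{M}\subseteq\mathcal{E}$ be a smooth embedded Riemannian submanifold, and let $\mathcal{O}\subseteq\mathcal{E}$ be open with $\mathcal{M}\subseteq\mathcal{O}$. Let $\varphi$ be upper-$\mathcal{C}^2$ on $\mathcal{O}$ and let $\mathrm{R}:T\mathcal{M}\to\mathcal{M}$ be a retraction on $\mathcal{M}$. Then: (i) for every $\bar x\in\mathcal{M}$ there exist a constant $\tilde\kappa>0$, a radius $r>0$ and an open neighborhood $V\subseteq\mathcal{M}$ of $\bar x$ such that $$\varphi\big(\mathrm{R}_x(\xi_x)\big)-\big(\varphi(x)+\langle w_{\mathcal{M}},\xi_x\rangle\big)\le\tilde\kappa\,\|\xi_x\|^2$$ for all $x\in V$, all $\xi_x\in T_x\mathcal{M}$ with $\|\xi_x\|\le r$, and all $w_{\mathcal{M}}\in\partial_{\mathcal{M}}\varphi(x)$; and (ii) the set-valued map $\partial_{\mathcal{M}}\varphi$ is locally bounded on $\mathcal{M}$.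
   Context: $\mathcal{E}$ is a Euclidean space (finite-dimensional real Hilbert space) with inner product $\langle\cdot,\cdot\rangle$ and induced norm $\|\cdot\|$; $\overline{\mathbb{R}}=(-\infty,+\infty]$. Smooth embedded submanifold: $\mathcal{M}\subseteq\mathcal{E}$ such that around each $\bar x\in\mathcal{M}$ there are an open neighborhood $U\subseteq\mathcal{E}$ and a $\mathcal{C}^1$ map $F:U\to\mathbb{R}^m$ with $\nabla F(\bar x)$ of rank $m$ ($m=\dim\mathcal{E}-\dim\mathcal{M}$) and $\mathcal{M}\cap U=\{x\in U: F(x)=0\}$. The tangent space is the linear subspace $T_x\mathcal{M}=\ker DF(x)\subseteq\mathcal{E}$, carrying the inner product inherited from $\mathcal{E}$ (so $\mathcal{M}$ is a Riemannian submanifold of $\mathcal{E}$); $T\mathcal{M}=\{(x,\xi): x\in\mathcal{M},\ \xi\in T_x\mathcal{M}\}$. Retraction: a smooth map $\mathrm{R}:T\mathcal{M}\to\mathcal{M}$, globally defined on $T\mathcal{M}$, where smooth means at least $\mathcal{C}^2$ (understood as: locally the restriction of a $\mathcal{C}^2$ map defined on an open subset of $\mathcal{E}\times\mathcal{E}$), such that for each $x\in\mathcal{M}$ the map $\mathrm{R}_x:=\mathrm{R}(x,\cdot):T_x\mathcal{M}\to\mathcal{M}$ satisfies $\mathrm{R}_x(0_x)=x$ and $D\mathrm{R}_x(0_x)=\mathrm{id}_{T_x\mathcal{M}}$. Upper-$\mathcal{C}^2$: for $U\subseteq\mathcal{E}$ open, $\varphi:U\to\mathbb{R}$ is upper-$\mathcal{C}^2$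 on $U$ if on some neighborhood $V$ of each $\bar x\in U$ there is a representation $\varphi(x)=\min_{c\in C}\varphi_c(x)$, where the $\varphi_c$ are of class $\mathcal{C}^2$ on $V$, $C$ is a compact topological space, and $\varphi_c(x)$ and its first- and second-order partial derivatives in $x$ depend continuously on $(x,c)\in V\times C$. Subdifferentials: for $g:\mathcal{E}\to\overline{\mathbb{R}}$ and $x$ with $g(x)<\infty$, the Fréchet subdifferential is $\hat\partial g(x)=\{v\in\mathcal{E}:\liminf_{y\to x,\,y\ne x}\frac{g(y)-g(x)-\langle v,y-x\rangle}{\|y-x\|}\ge 0\}$, and the limiting subdifferential $\partial g(x)$ is the set of $v\in\mathcal{E}$ for which there are $x^k\to x$ with $g(x^k)\to g(x)$ and $v^k\in\hat\partial g(x^k)$ with $v^k\to v$. With $\delta_{\mathcal{M}}$ the indicator function of $\mathcal{M}$ ($0$ on $\mathcal{M}$, $+\infty$ elsewhere), the projectional (limiting) subdifferential of $\varphi$ at $x\in\mathcal{M}$ relative to $\mathcal{M}$ is $\partial_{\mathcal{M}}\varphi(x):=\mathrm{proj}_{T_x\mathcal{M}}\,\partial(\varphi+\delta_{\mathcal{M}})(x)$, where $\mathrm{proj}_{T_x\mathcal{M}}$ is orthogonal projection and $\varphi+\delta_{\mathcal{M}}$ is $+\infty$ off $\mathcal{M}$. It also equals $\partial(\varphi+\delta_{\mathcal{M}})(x)\cap T_x\mathcal{M}$. Locally bounded: each $\bar x\in\mathcal{M}$ has a neighborhood $V$ in $\mathcal{M}$ such that $\bigcup_{x\in V}\partial_{\mathcal{M}}\varphi(x)$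 is bounded. *)

theory Defs
  imports "HOL-Analysis.Analysis"
begin

section \<open>Functions of class \<open>C\<^sup>2\<close>\<close>

definition C2_with_derivs ::
  "'a::real_normed_vector set \<Rightarrow> ('a \<Rightarrow> 'b::real_normed_vector)
    \<Rightarrow> ('a \<Rightarrow> 'a \<Rightarrow>\<^sub>L 'b) \<Rightarrow> ('a \<Rightarrow> 'a \<Rightarrow>\<^sub>L 'a \<Rightarrow>\<^sub>L 'b) \<Rightarrow> bool" where
  "C2_with_derivs S f D1 D2 \<longleftrightarrow>
     (\<forall>x\<in>S. (f has_derivative blinfun_apply (D1 x)) (at x) \<and>
            (D1 has_derivative blinfun_apply (D2 x)) (at x)) \<and>
     continuous_on S D2"

definition C2_on :: "'a::real_normed_vector set \<Rightarrow> ('a \<Rightarrow> 'b::real_normed_vector) \<Rightarrow> bool" where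
  "C2_on S f \<longleftrightarrow> (\<exists>D1 D2. C2_with_derivs S f D1 D2)"


section \<open>Embedded submanifolds and retractions\<close>

text \<open>
  A \<open>C\<^sup>1\<close> map \<open>U \<rightarrow> \<real>\<^sup>m\<close> is given by its components \<open>F i\<close>, \<open>i < m\<close>, with gradients
  \<open>G i\<close>. The rank of its derivative at \<open>x\<close> is the row rank, that is, the dimension of the span
  of the gradients \<open>G i x\<close>.
\<close>
definition local_defining_map ::
  "nat \<Rightarrow> 'a::euclidean_space set \<Rightarrow> 'a \<Rightarrow> 'a set \<Rightarrow> (nat \<Rightarrow> 'a \<Rightarrow> real) \<Rightarrow> (nat \<Rightarrow> 'a \<Rightarrow> 'a) \<Rightarrow> bool" where
  "local_defining_map m M x U F G \<longleftrightarrow>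
     open U \<and> x \<in> U \<and>
     (\<forall>i<m. (\<forall>y\<in>U. GDERIV (F i) y :> G i y) \<and> continuous_on U (G i)) \<and>
     dim ((\<lambda>i. G i x) ` {..<m}) = m \<and>
     M \<inter> U = {y \<in> U. \<forall>i<m. F i y = 0}"

text \<open>The codimension \<open>m\<close> is the same at all points of \<open>M\<close>.\<close>
definition embedded_submanifold :: "'a::euclidean_space set \<Rightarrow> bool" where
  "embedded_submanifold M \<longleftrightarrow> (\<exists>m. \<forall>x\<in>M. \<exists>U F G. local_defining_map m M x U F G)"

text \<open>
  The kernel of the derivative at \<open>x\<close> of a local defining map around \<open>x\<close>; for \<open>x \<in> M\<close> it does
  not depend on the choice of that map.
\<close>
definition tangent_space :: "'a::euclidean_space set \<Rightarrow> 'a \<Rightarrow> 'a set" where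
  "tangent_space M x =
     {v. \<exists>m U F G. local_defining_map m M x U F G \<and> (\<forall>i<m. inner (G i x) v = 0)}"

definition tangent_bundle :: "'a::euclidean_space set \<Rightarrow> ('a \<times> 'a) set" where
  "tangent_bundle M = (SIGMA x:M. tangent_space M x)"

text \<open>
  Only the values of \<open>R\<close> on the tangent bundle matter. The derivative of \<open>R\<^sub>x\<close> at \<open>0\<close> is taken
  within the tangent space; as a linear map on that subspace it is unique.
\<close>
definition retraction_on_manifold :: "'a::euclidean_space set \<Rightarrow> ('a \<times> 'a \<Rightarrow> 'a) \<Rightarrow> bool" where
  "retraction_on_manifold M R \<longleftrightarrow>
     R ` tangent_bundle M \<subseteq> M \<and>
     (\<forall>p\<in>tangent_bundle M. \<exists>W R'. open W \<and> p \<in> W \<and> C2_on W R' \<and>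
        (\<forall>q\<in>tangent_bundle M \<inter> W. R q = R' q)) \<and>
     (\<forall>x\<in>M. R (x, 0) = x \<and>
        ((\<lambda>v. R (x, v)) has_derivative (\<lambda>v. v)) (at 0 within tangent_space M x))"


section \<open>Upper-\<open>C\<^sup>2\<close> functions\<close>

text \<open>
  The compact spaces indexing the local representations are carried by subsets of the type \<open>'c\<close>.
  HOL cannot quantify over types inside the definition, so the type is a parameter; a statement
  in which \<open>'c\<close> is a free type variable covers arbitrary compact index spaces. Continuity of
  \<open>D1\<close> and \<open>D2\<close> in operator norm is continuity of all first and second partial derivatives,
  \<open>'a\<close> being finite-dimensional.
\<close>
definition upper_C2_on :: "'c itself \<Rightarrow> 'a::euclidean_space set \<Rightarrow> ('a \<Rightarrow> real) \<Rightarrow> bool" where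
  "upper_C2_on _ U \<phi> \<longleftrightarrow>
     (\<forall>x0\<in>U. \<exists>V (C :: 'c topology) f D1 D2.
        open V \<and> x0 \<in> V \<and> V \<subseteq> U \<and> compact_space C \<and>
        (\<forall>c\<in>topspace C. C2_with_derivs V (f c) (D1 c) (D2 c)) \<and>
        continuous_map (prod_topology (top_of_set V) C) euclidean (\<lambda>(x, c). f c x) \<and>
        continuous_map (prod_topology (top_of_set V) C) euclidean (\<lambda>(x, c). D1 c x) \<and>
        continuous_map (prod_topology (top_of_set V) C) euclidean (\<lambda>(x, c). D2 c x) \<and>
        (\<forall>x\<in>V. (\<exists>c\<in>topspace C. \<phi> x = f c x) \<and> (\<forall>c\<in>topspace C. \<phi> x \<le> f c x)))"


section \<open>Subdifferentials\<close>

text \<open>Both subdifferentials are empty at points where the function is not finite.\<close>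

definition frechet_subdifferential :: "('a::euclidean_space \<Rightarrow> ereal) \<Rightarrow> 'a \<Rightarrow> 'a set" where
  "frechet_subdifferential g x =
     {v. \<bar>g x\<bar> \<noteq> \<infinity> \<and>
         0 \<le> Liminf (at x) (\<lambda>y. (g y - g x - ereal (inner v (y - x))) / ereal (norm (y - x)))}"

definition limiting_subdifferential :: "('a::euclidean_space \<Rightarrow> ereal) \<Rightarrow> 'a \<Rightarrow> 'a set" where
  "limiting_subdifferential g x =
     {v. \<bar>g x\<bar> \<noteq> \<infinity> \<and>
         (\<exists>xs vs. xs \<longlonglongrightarrow> x \<and> (\<lambda>k. g (xs k)) \<longlonglongrightarrow> g x \<and>
            (\<forall>k. vs k \<in> frechet_subdifferential g (xs k)) \<and> vs \<longlonglongrightarrow> v)}"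

definition indicator_function :: "'a set \<Rightarrow> 'a \<Rightarrow> ereal" where
  "indicator_function M y = (if y \<in> M then 0 else \<infinity>)"

definition orthogonal_projection :: "'a::euclidean_space set \<Rightarrow> 'a \<Rightarrow> 'a" where
  "orthogonal_projection T v = (THE p. p \<in> T \<and> (\<forall>t\<in>T. orthogonal (v - p) t))"

text \<open>
  The values of \<open>\<phi>\<close> outside \<open>M\<close> are irrelevant, as the sum is \<open>\<infinity>\<close> there.
\<close>
definition proj_subdifferential :: "'a::euclidean_space set \<Rightarrow> ('a \<Rightarrow> real) \<Rightarrow> 'a \<Rightarrow> 'a set" where
  "proj_subdifferential M \<phi> x =
     orthogonal_projection (tangent_space M x) `
       limiting_subdifferential (\<lambda>y. ereal (\<phi> y) + indicator_function M y) x"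

definition locally_bounded_on :: "'a::topological_space set \<Rightarrow> ('a \<Rightarrow> 'b::metric_space set) \<Rightarrow> bool" where
  "locally_bounded_on M S \<longleftrightarrow>
     (\<forall>x0\<in>M. \<exists>V. openin (top_of_set M) V \<and> x0 \<in> V \<and> bounded (\<Union>x\<in>V. S x))"

end

theory Submission
  imports Defs
begin

text \<open>
  A Frechet subgradient \<open>v\<close> of \<open>\<phi> + \<delta>\<^sub>M\<close> at \<open>y\<close> is also one of \<open>f\<^sub>c + \<delta>\<^sub>M\<close> for every \<open>f\<^sub>c\<close> active at \<open>y\<close>,
  so \<open>v - \<nabla>f\<^sub>c(y)\<close> annihilates the velocities of the curves \<open>t \<mapsto> R(y, t\<xi>)\<close>, that is, the tangent space.
  Taylor expansion of \<open>f\<^sub>c\<close> together with \<open>R(y, \<xi>) = y + \<xi> + O(\<parallel>\<xi>\<parallel>\<^sup>2)\<close> then gives the inequality of (i)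
  for \<open>v\<close>, uniformly near \<open>x0\<close>. It passes to limiting subgradients because every tangent vector at
  \<open>x\<close> is a limit of tangent vectors at nearby points: all tangent spaces have the same dimension, and
  limits of orthonormal bases are orthonormal bases. Finally (ii) follows from (i) by inserting
  \<open>\<xi> = - r w / \<parallel>w\<parallel>\<close> and using that \<open>\<phi> \<circ> R\<close> is bounded near \<open>(x0, 0)\<close>.
\<close>

section \<open>Second-order estimates\<close>

text \<open>The mean value inequality is used twice: on \<open>D1\<close>, which becomes
  \<open>B\<close>-Lipschitz about \<open>y\<close>, and then on \<open>f\<close> minus its
  linearization at \<open>y\<close>. This gives \<open>B\<close> in place of the sharp
  \<open>B / 2\<close>; only a uniform constant matters below.\<close>

lemma C2_with_derivs_quadratic_bound:
  assumes f: "C2_with_derivs S f D1 D2" and T: "convex T" "T \<subseteq> S"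
    and B: "\<And>x. x \<in> T \<Longrightarrow> norm (D2 x) \<le> B" and yz: "y \<in> T" "z \<in> T"
  shows "norm (f z - f y - D1 y (z - y)) \<le> B * (norm (z - y))\<^sup>2"
proof -
  have df: "(f has_derivative blinfun_apply (D1 x)) (at x within T)"
    and dD: "(D1 has_derivative blinfun_apply (D2 x)) (at x within T)" if "x \<in> T" for x
    using f T that unfolding C2_with_derivs_def by (blast intro: has_derivative_at_withinI)+
  have B0: "0 \<le> B" using B[OF yz(1)] norm_ge_zero order_trans by blast
  have lip: "norm (D1 x - D1 y) \<le> B * norm (x - y)" if "x \<in> T" for x
    using differentiable_bound[OF T(1) dD, of B x y] that yz B
    by (simp add: norm_blinfun.rep_eq)
  have seg: "y + t *\<^sub>R (z - y) \<in> T" if "t \<in> {0..1}" for t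
  proof -
    have "(1 - t) *\<^sub>R y + t *\<^sub>R z \<in> T"
      using T(1) yz that by (intro convexD) auto
    then show ?thesis by (simp add: algebra_simps)
  qed
  \<comment> \<open>On the segment \<open>Q\<close> the distance to \<open>y\<close> never exceeds
    \<open>norm (z - y)\<close>, so the Lipschitz bound on \<open>D1\<close> becomes a single
    constant there.\<close>
  define Q where "Q = (\<lambda>t. y + t *\<^sub>R (z - y)) ` {0..1::real}"
  have QT: "Q \<subseteq> T" using seg by (auto simp: Q_def)
  have nQ: "norm (x - y) \<le> norm (z - y)" if "x \<in> Q" for x
    using that mult_right_mono[of _ "1::real" "norm (z - y)"] by (auto simp: Q_def)
  have "norm (f z - f y - D1 y (z - y)) \<le> norm (z - y) * (B * norm (z - y))"
  proof (rule differentiable_bound_linearization[where f = f and S = Q and f' = "\<lambda>x. blinfun_apply (D1 x)"])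
    show "y + t *\<^sub>R (z - y) \<in> Q" if "t \<in> {0..1}" for t using that by (auto simp: Q_def)
    show "(f has_derivative blinfun_apply (D1 x)) (at x within Q)" if "x \<in> Q" for x
      using df QT that has_derivative_subset by blast
    show "onorm (blinfun_apply (D1 x) - blinfun_apply (D1 y)) \<le> B * norm (z - y)" if "x \<in> Q" for x
    proof -
      have "norm (D1 x - D1 y) \<le> B * norm (z - y)"
        using lip[of x] nQ[OF that] QT that B0 by (meson mult_left_mono order_trans subsetD)
      then show ?thesis by (simp add: norm_blinfun.rep_eq minus_blinfun.rep_eq fun_diff_def)
    qed
    show "y \<in> Q" unfolding Q_def by (auto intro: image_eqI[of _ _ 0])
  qed
  then show ?thesis by (simp add: power2_eq_square mult_ac)
qed

text \<open>For \<open>h\<close> a derivative of the indexed family, this gives a bound uniform in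
  both the point and the index.\<close>

lemma continuous_map_prod_compact_bounded:
  fixes h :: "'a::topological_space \<times> 'c \<Rightarrow> 'b::real_normed_vector"
  assumes h: "continuous_map (prod_topology (top_of_set V) C) euclidean h"
    and "compact_space C" "compact K" "K \<subseteq> V"
  shows "bounded (h ` (K \<times> topspace C))"
proof -
  have "compactin (prod_topology (top_of_set V) C) (K \<times> topspace C)"
    using assms unfolding compactin_Times
    by (auto simp: compactin_subtopology compact_space_def)
  then have "compactin euclidean (h ` (K \<times> topspace C))"
    using h image_compactin by blast
  then show ?thesis by (simp add: compact_imp_bounded)
qed

text \<open>All that is used of an upper-\<open>C\<^sup>2\<close> function is a family of quadratic majorants touching its
  graph, with constants that are locally uniform by compactness of the index space.\<close>

lemma upper_C2_on_quadratic_majorant: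
  fixes \<phi> :: "'a::euclidean_space \<Rightarrow> real"
  assumes "upper_C2_on TYPE('c) U \<phi>" and "x0 \<in> U"
  obtains \<rho> L where "\<rho> > 0" "L \<ge> 0"
    "\<And>y. y \<in> cball x0 \<rho> \<Longrightarrow> \<exists>D. norm D \<le> L \<and>
        (\<forall>z\<in>cball x0 \<rho>. \<phi> z \<le> \<phi> y + blinfun_apply D (z - y) + L * (norm (z - y))\<^sup>2)"
proof -
  from assms(1)[unfolded upper_C2_on_def, rule_format, OF assms(2)]
  obtain V and C :: "'c topology" and f D1 D2 where V: "open V" "x0 \<in> V"
    and C: "compact_space C"
    and f: "\<forall>c\<in>topspace C. C2_with_derivs V (f c) (D1 c) (D2 c)"
    and c1: "continuous_map (prod_topology (top_of_set V) C) euclidean (\<lambda>(x, c). D1 c x)"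
    and c2: "continuous_map (prod_topology (top_of_set V) C) euclidean (\<lambda>(x, c). D2 c x)"
    and min: "\<forall>x\<in>V. (\<exists>c\<in>topspace C. \<phi> x = f c x) \<and> (\<forall>c\<in>topspace C. \<phi> x \<le> f c x)"
    by (elim exE conjE) (rule that)
  obtain \<rho> where \<rho>: "\<rho> > 0" "cball x0 \<rho> \<subseteq> V" using V open_contains_cball by blast
  obtain L1 where "\<forall>v\<in>(\<lambda>(x, c). D1 c x) ` (cball x0 \<rho> \<times> topspace C). norm v \<le> L1"
    using continuous_map_prod_compact_bounded[OF c1 C compact_cball \<rho>(2)]
    unfolding bounded_iff by blast
  then have L1: "norm (D1 c x) \<le> L1" if "x \<in> cball x0 \<rho>" "c \<in> topspace C" for x c
    using that by fastforce
  obtain L2 where "\<forall>v\<in>(\<lambda>(x, c). D2 c x) ` (cball x0 \<rho> \<times> topspace C). norm v \<le> L2"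
    using continuous_map_prod_compact_bounded[OF c2 C compact_cball \<rho>(2)]
    unfolding bounded_iff by blast
  then have L2: "norm (D2 c x) \<le> L2" if "x \<in> cball x0 \<rho>" "c \<in> topspace C" for x c
    using that by fastforce
  \<comment> \<open>One constant bounds both the first derivatives and the quadratic
    remainders.\<close>
  define L where "L = max 0 (max L1 L2)"
  show thesis
  proof (rule that[OF \<rho>(1), of L])
    show "L \<ge> 0" by (simp add: L_def)
    fix y assume y: "y \<in> cball x0 \<rho>"
    \<comment> \<open>The majorant comes from an index active at \<open>y\<close>:
      \<open>f c\<close> equals \<open>\<phi>\<close> at \<open>y\<close> and dominates it on
      \<open>V\<close>.\<close>
    then obtain c where c: "c \<in> topspace C" "\<phi> y = f c y" using min \<rho>(2) by blast
    have "\<phi> z \<le> \<phi> y + D1 c y (z - y) + L * (norm (z - y))\<^sup>2" if z: "z \<in> cball x0 \<rho>" for z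
    proof -
      have "norm (f c z - f c y - D1 c y (z - y)) \<le> L * (norm (z - y))\<^sup>2"
        using bspec[OF f c(1)] \<rho>(2) y z L2[OF _ c(1)]
        by (intro C2_with_derivs_quadratic_bound[where ?D2.0 = "D2 c" and ?T = "cball x0 \<rho>"])
          (auto simp: L_def le_max_iff_disj)
      moreover have "\<phi> z \<le> f c z" using min c(1) z \<rho>(2) by blast
      ultimately show ?thesis using c(2) by (simp add: abs_le_iff)
    qed
    moreover have "norm (D1 c y) \<le> L" using L1[OF y c(1)] by (simp add: L_def)
    ultimately show "\<exists>D. norm D \<le> L \<and>
        (\<forall>z\<in>cball x0 \<rho>. \<phi> z \<le> \<phi> y + blinfun_apply D (z - y) + L * (norm (z - y))\<^sup>2)"
      by blast
  qed
qed

text \<open>The majorant at \<open>y\<close> bounds \<open>\<phi> z - \<phi> y\<close> from above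
  and the one at \<open>z\<close> bounds it from below, so one-sided bounds at every point force
  continuity.\<close>

lemma quadratic_majorant_imp_continuous_on:
  fixes \<phi> :: "'a::real_normed_vector \<Rightarrow> real"
  assumes L: "L \<ge> 0"
    and maj: "\<And>y. y \<in> S \<Longrightarrow> \<exists>D. norm D \<le> L \<and>
        (\<forall>z\<in>S. \<phi> z \<le> \<phi> y + blinfun_apply D (z - y) + L * (norm (z - y))\<^sup>2)"
  shows "continuous_on S \<phi>"
proof -
  have up: "\<phi> z - \<phi> y \<le> L * norm (z - y) + L * (norm (z - y))\<^sup>2"
    if yz: "y \<in> S" "z \<in> S" for y z
  proof -
    obtain D where D: "norm D \<le> L"
        "\<phi> z \<le> \<phi> y + blinfun_apply D (z - y) + L * (norm (z - y))\<^sup>2"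
      using maj yz by blast
    have "blinfun_apply D (z - y) \<le> norm D * norm (z - y)"
      using norm_blinfun[of D "z - y"] by simp
    also have "\<dots> \<le> L * norm (z - y)" using D(1) by (simp add: mult_right_mono)
    finally show ?thesis using D(2) by simp
  qed
  have "(\<phi> \<longlongrightarrow> \<phi> y) (at y within S)" if y: "y \<in> S" for y
  proof (rule LIM_zero_cancel, rule tendsto_rabs_zero_cancel,
      rule tendsto_sandwich[of "\<lambda>_. 0" _ _ "\<lambda>z. L * norm (z - y) + L * (norm (z - y))\<^sup>2"])
    show "\<forall>\<^sub>F z in at y within S. \<bar>\<phi> z - \<phi> y\<bar> \<le> L * norm (z - y) + L * (norm (z - y))\<^sup>2"
      unfolding eventually_at_filter
    proof (rule always_eventually, intro allI impI)
      fix z assume "z \<in> S"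
      then show "\<bar>\<phi> z - \<phi> y\<bar> \<le> L * norm (z - y) + L * (norm (z - y))\<^sup>2"
        using up[of y z] up[of z y] y by (auto simp: abs_le_iff norm_minus_commute)
    qed
    show "((\<lambda>z. L * norm (z - y) + L * (norm (z - y))\<^sup>2) \<longlongrightarrow> 0) (at y within S)"
      by (auto intro!: tendsto_eq_intros)
  qed auto
  then show ?thesis by (simp add: continuous_on_def)
qed

section \<open>Tangent spaces\<close>

text \<open>A multiple of \<open>\<xi>\<close> has the same defining map as witness. Sums could
  involve two different maps and wait until the kernel is known to be independent of the
  map.\<close>

lemma tangent_space_scaleR:
  assumes "\<xi> \<in> tangent_space M x"
  shows "t *\<^sub>R \<xi> \<in> tangent_space M x"
proof -
  obtain m U F G where "local_defining_map m M x U F G" "\<forall>i<m. inner (G i x) \<xi> = 0"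
    using assms unfolding tangent_space_def by blast
  moreover from this have "\<forall>i<m. inner (G i x) (t *\<^sub>R \<xi>) = 0" by simp
  ultimately show ?thesis unfolding tangent_space_def by blast
qed

text \<open>Every tangent vector is the velocity of a curve in \<open>M\<close>; all first-order
  arguments below run along these curves.\<close>

lemma retraction_curve:
  assumes R: "retraction_on_manifold M R" and x: "x \<in> M" and \<xi>: "\<xi> \<in> tangent_space M x"
  shows "R (x, t *\<^sub>R \<xi>) \<in> M"
    and "((\<lambda>t. R (x, t *\<^sub>R \<xi>)) has_vector_derivative \<xi>) (at 0)"
proof -
  have T: "t *\<^sub>R \<xi> \<in> tangent_space M x" for t using tangent_space_scaleR[OF \<xi>] .
  show "R (x, t *\<^sub>R \<xi>) \<in> M"
    using R T[of t] x unfolding retraction_on_manifold_def tangent_bundle_def by blast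
  have "((\<lambda>v. R (x, v)) has_derivative (\<lambda>v. v)) (at (0 *\<^sub>R \<xi>) within tangent_space M x)"
    using R x unfolding retraction_on_manifold_def by simp
  \<comment> \<open>Restricting the derivative to the line through \<open>\<xi>\<close> makes the
    chain rule applicable with a free real parameter \<open>t\<close>.\<close>
  then have "((\<lambda>v. R (x, v)) has_derivative (\<lambda>v. v)) (at (0 *\<^sub>R \<xi>) within (\<lambda>t. t *\<^sub>R \<xi>) ` UNIV)"
    by (rule has_derivative_subset) (use T in blast)
  moreover have "((\<lambda>t. t *\<^sub>R \<xi>) has_derivative (\<lambda>t. t *\<^sub>R \<xi>)) (at 0)"
    by (auto intro!: derivative_eq_intros)
  ultimately have "((\<lambda>t. R (x, t *\<^sub>R \<xi>)) has_derivative (\<lambda>t. t *\<^sub>R \<xi>)) (at 0)"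
    using has_derivative_in_compose[of "\<lambda>t. t *\<^sub>R \<xi>" _ 0 UNIV] by blast
  then show "((\<lambda>t. R (x, t *\<^sub>R \<xi>)) has_vector_derivative \<xi>) (at 0)"
    by (simp add: has_vector_derivative_def)
qed

text \<open>The curves of the retraction replace the implicit function theorem here. The base point
  \<open>x\<close> of the defining map may differ from \<open>y\<close>, and no rank condition at \<open>y\<close> enters.\<close>

lemma tangent_space_orthogonal_gradients:
  assumes R: "retraction_on_manifold M R" and F: "local_defining_map m M x U F G"
    and y: "y \<in> M \<inter> U" and \<xi>: "\<xi> \<in> tangent_space M y" and i: "i < m"
  shows "inner (G i y) \<xi> = 0"
proof -
  let ?z = "\<lambda>t. R (y, t *\<^sub>R \<xi>)"
  have z0: "?z 0 = y" using R y unfolding retraction_on_manifold_def by simp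
  have zM: "?z t \<in> M" and dz: "(?z has_vector_derivative \<xi>) (at 0)" for t
    using retraction_curve[OF R _ \<xi>] y by auto
  have U: "open U" and MU: "M \<inter> U = {y \<in> U. \<forall>i<m. F i y = 0}"
    and dF: "GDERIV (F i) y :> G i y"
    using F y i unfolding local_defining_map_def by auto
  have "((\<lambda>t. F i (?z t)) has_derivative (\<lambda>t. inner (t *\<^sub>R \<xi>) (G i y))) (at 0)"
    by (rule has_derivative_compose[OF dz[unfolded has_vector_derivative_def], of "F i"])
      (use dF z0 in \<open>simp add: gderiv_def\<close>)
  then have d1: "((\<lambda>t. F i (?z t)) has_vector_derivative inner (G i y) \<xi>) (at 0)"
    by (simp add: has_vector_derivative_def inner_commute)
  have "(?z \<longlongrightarrow> ?z 0) (at 0)"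
    using has_vector_derivative_continuous[OF dz] unfolding isCont_def .
  then have "\<forall>\<^sub>F t in at 0. ?z t \<in> U"
    using topological_tendstoD U y z0 by fastforce
  \<comment> \<open>The curve stays in \<open>M\<close>, where \<open>F i\<close> vanishes near
    \<open>y\<close>; the composite is locally constant, so its derivative at 0 is zero.\<close>
  then have "\<forall>\<^sub>F t in at 0. F i (?z t) = 0"
    by eventually_elim (use zM MU i in blast)
  moreover have "F i (?z 0) = 0" using z0 y MU i by auto
  ultimately have "((\<lambda>t. 0) has_vector_derivative inner (G i y) \<xi>) (at (0::real))"
    using d1 has_derivative_transform_eventually[of "\<lambda>t. F i (?z t)" _ 0 UNIV "\<lambda>_. 0"]
    unfolding has_vector_derivative_def by auto
  then show ?thesis
    using vector_derivative_unique_at has_vector_derivative_const by blast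
qed

text \<open>A vector tangent by some other defining map is orthogonal to the gradients of this one
  by the preceding lemma; hence the kernel does not depend on the map.\<close>

lemma tangent_space_eq_kernel:
  assumes "retraction_on_manifold M R" "local_defining_map m M x U F G" "x \<in> M"
  shows "tangent_space M x = {v. \<forall>i<m. inner (G i x) v = 0}"
proof -
  have "x \<in> M \<inter> U" using assms unfolding local_defining_map_def by blast
  then show ?thesis
    using tangent_space_orthogonal_gradients[OF assms(1,2)] assms(2)
    unfolding tangent_space_def by blast
qed

lemma subspace_tangent_space:
  assumes "embedded_submanifold M" "retraction_on_manifold M R" "x \<in> M"
  shows "subspace (tangent_space M x)"
proof -
  obtain m U F G where "local_defining_map m M x U F G"
    using assms unfolding embedded_submanifold_def by blast
  from tangent_space_eq_kernel[OF assms(2) this assms(3)] show ?thesis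
    by (auto simp: subspace_def inner_add_right)
qed

text \<open>The tangent space is the orthogonal complement of the span of the gradients, which has
  dimension \<open>m\<close> by the rank condition.\<close>

lemma dim_tangent_space:
  fixes M :: "'a::euclidean_space set"
  assumes "retraction_on_manifold M R" "local_defining_map m M x U F G" "x \<in> M"
  shows "dim (tangent_space M x) + m = DIM('a)"
proof -
  let ?A = "(\<lambda>i. G i x) ` {..<m}"
  have "tangent_space M x = {y \<in> UNIV. \<forall>a \<in> span ?A. orthogonal a y}"
  proof (intro set_eqI iffI)
    fix v assume "v \<in> tangent_space M x"
    then have "orthogonal v a" if "a \<in> ?A" for a
      using that by (auto simp: tangent_space_eq_kernel[OF assms] orthogonal_def inner_commute)
    then show "v \<in> {y \<in> UNIV. \<forall>a \<in> span ?A. orthogonal a y}"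
      using orthogonal_to_span orthogonal_commute by blast
  next
    fix v assume "v \<in> {y \<in> UNIV. \<forall>a \<in> span ?A. orthogonal a y}"
    then have "\<forall>a\<in>span ?A. orthogonal a v" by simp
    then have "orthogonal a v" if "a \<in> ?A" for a using span_base[OF that] by (rule bspec)
    then show "v \<in> tangent_space M x"
      by (auto simp: tangent_space_eq_kernel[OF assms] orthogonal_def)
  qed
  then have "dim (tangent_space M x) + dim (span ?A) = dim (UNIV :: 'a set)"
    using dim_subspace_orthogonal_to_vectors[of "span ?A" UNIV] by simp
  moreover have "dim ?A = m" using assms(2) unfolding local_defining_map_def by simp
  ultimately show ?thesis by simp
qed

section \<open>Limits of subspaces of constant dimension\<close>

lemma bounded_functions_convergent_subsequence:
  fixes b :: "nat \<Rightarrow> nat \<Rightarrow> 'a::euclidean_space"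
  assumes "\<And>k i. norm (b k i) \<le> B"
  obtains r l where "strict_mono r" "\<And>i. (\<lambda>k. b (r k) i) \<longlonglongrightarrow> l i"
proof -
  \<comment> \<open>A product of balls is compact by Tychonoff, and sequentially compact since
    functions on \<open>nat\<close> carry a metric. So one subsequence serves all indices
    \<open>i\<close>.\<close>
  let ?S = "PiE UNIV (\<lambda>i::nat. cball (0::'a) B)"
  have "compactin (product_topology (\<lambda>i. euclidean) UNIV) ?S"
    unfolding compactin_PiE by simp
  then have "compact ?S" by (simp add: euclidean_product_topology)
  then have "seq_compact ?S" by (simp add: compact_eq_seq_compact_metric)
  moreover have "\<forall>k. b k \<in> ?S" using assms by auto
  ultimately obtain l r where r: "strict_mono r" and l: "(b \<circ> r) \<longlonglongrightarrow> l"
    using seq_compactE by metis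
  have "(\<lambda>k. b (r k) i) \<longlonglongrightarrow> l i" for i
    using continuous_on_tendsto_compose[OF continuous_on_product_coordinates[of i] l] by simp
  with r show thesis by (rule that)
qed

text \<open>Orthonormal bases of the \<open>S k\<close> converge along a subsequence. Their limits
  are orthonormal and lie in \<open>T\<close> by \<open>cl\<close>, hence form a basis of
  \<open>T\<close>. The coefficients of \<open>\<xi>\<close> in the limit basis, used with the bases
  of \<open>S (r k)\<close>, produce \<open>\<eta> k\<close>.\<close>

lemma subspace_limit_approximation:
  fixes S :: "nat \<Rightarrow> 'a::euclidean_space set"
  assumes S: "\<And>k. subspace (S k)" "\<And>k. dim (S k) = dim T" and T: "subspace T"
    and cl: "\<And>r v w. strict_mono r \<Longrightarrow> (\<And>k. v k \<in> S (r k)) \<Longrightarrow> v \<longlonglongrightarrow> w \<Longrightarrow> w \<in> T"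
    and \<xi>: "\<xi> \<in> T"
  obtains r \<eta> where "strict_mono r" "\<And>k. \<eta> k \<in> S (r k)" "\<eta> \<longlonglongrightarrow> \<xi>"
proof -
  let ?d = "dim T"
  have "\<exists>b. \<forall>i<?d. b i \<in> S k \<and> (\<forall>j<?d. inner (b i) (b j) = (if i = j then 1 else 0))" for k
  proof -
    obtain B where B: "B \<subseteq> S k" "pairwise orthogonal B" "\<And>x. x \<in> B \<Longrightarrow> norm x = 1"
        "independent B" "card B = dim (S k)"
      using orthonormal_basis_subspace[OF S(1)] by metis
    have "finite B" using B(4) independent_imp_finite by blast
    then obtain b where b: "bij_betw b {0..<card B} B" using ex_bij_betw_nat_finite by blast
    have mem: "b i \<in> B" if "i < ?d" for i using b that B(5) S(2) by (auto simp: bij_betw_def)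
    have "inner (b i) (b j) = (if i = j then 1 else 0)" if "i < ?d" "j < ?d" for i j
    proof (cases "i = j")
      case True then show ?thesis using B(3)[OF mem[OF that(1)]] by (simp add: norm_eq_1)
    next
      case False
      then have "b i \<noteq> b j" using b that B(5) S(2) by (auto simp: bij_betw_def inj_on_def)
      then show ?thesis using False B(2) mem that by (auto simp: pairwise_def orthogonal_def)
    qed
    then show ?thesis using mem B(1) by blast
  qed
  then obtain b where b: "\<And>k i. i < ?d \<Longrightarrow> b k i \<in> S k"
      "\<And>k i j. i < ?d \<Longrightarrow> j < ?d \<Longrightarrow> inner (b k i) (b k j) = (if i = j then 1 else 0)"
    by metis
  \<comment> \<open>Padding with 0 beyond \<open>?d\<close> makes the family bounded over all
    natural indices.\<close>
  have "norm (if i < ?d then b k i else 0) \<le> 1" for k i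
    using b(2)[of i i k] by (auto simp: norm_eq_sqrt_inner)
  then obtain r l where r: "strict_mono r"
    and l0: "\<And>i. (\<lambda>k. if i < ?d then b (r k) i else 0) \<longlonglongrightarrow> l i"
    using bounded_functions_convergent_subsequence[of "\<lambda>k i. if i < ?d then b k i else 0"] by blast
  have l: "(\<lambda>k. b (r k) i) \<longlonglongrightarrow> l i" if "i < ?d" for i
    using l0[of i] that by simp
  have lT: "l i \<in> T" if "i < ?d" for i using cl[OF r _ l] b(1) that by blast
  have inner_l: "inner (l i) (l j) = (if i = j then 1 else 0)" if "i < ?d" "j < ?d" for i j
    using tendsto_inner[OF l[OF that(1)] l[OF that(2)]] b(2)[OF that]
    by (simp add: LIMSEQ_const_iff)
  have inj: "inj_on l {..<?d}"
  proof (rule inj_onI)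
    fix i j assume "i \<in> {..<?d}" "j \<in> {..<?d}" "l i = l j"
    then show "i = j" using inner_l[of i j] inner_l[of i i] by (auto split: if_splits)
  qed
  have "pairwise orthogonal (l ` {..<?d})"
    using inner_l by (auto simp: pairwise_def orthogonal_def)
  moreover have "0 \<notin> l ` {..<?d}" using inner_l by fastforce
  ultimately have "independent (l ` {..<?d})" by (rule pairwise_orthogonal_independent)
  then have "dim (l ` {..<?d}) = ?d" by (simp add: dim_eq_card_independent card_image[OF inj])
  moreover have "l ` {..<?d} \<subseteq> T" using lT by blast
  ultimately have "span (l ` {..<?d}) = T"
    using T by (metis dim_eq_span order_refl span_eq_iff)
  \<comment> \<open>\<open>u\<close> assigns coefficients to the vectors of the set; injectivity of
    \<open>l\<close> turns the expansion into a sum over indices.\<close>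
  then obtain u where "\<xi> = (\<Sum>v\<in>l ` {..<?d}. u v *\<^sub>R v)"
    using \<xi> span_finite[of "l ` {..<?d}"] by auto
  then have \<xi>_eq: "\<xi> = (\<Sum>i<?d. u (l i) *\<^sub>R l i)" by (simp add: sum.reindex[OF inj])
  show thesis
  proof (rule that[OF r])
    show "(\<Sum>i<?d. u (l i) *\<^sub>R b (r k) i) \<in> S (r k)" for k
      using S(1) b(1) by (intro subspace_sum subspace_scale) auto
    show "(\<lambda>k. \<Sum>i<?d. u (l i) *\<^sub>R b (r k) i) \<longlonglongrightarrow> \<xi>"
      unfolding \<xi>_eq using l by (intro tendsto_intros) auto
  qed
qed

text \<open>One defining map around \<open>x\<close> has continuous gradients that annihilate the
  tangent spaces at all nearby points of \<open>M\<close>. Limits of tangent vectors are therefore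
  tangent at \<open>x\<close>, which is the closedness that the approximation requires.\<close>

lemma tangent_space_limit_approximation:
  fixes M :: "'a::euclidean_space set"
  assumes M: "embedded_submanifold M" and R: "retraction_on_manifold M R"
    and xs: "\<And>k. xs k \<in> M" "xs \<longlonglongrightarrow> x" and x: "x \<in> M" and \<xi>: "\<xi> \<in> tangent_space M x"
  obtains r \<eta> where "strict_mono r" "\<And>k. \<eta> k \<in> tangent_space M (xs (r k))" "\<eta> \<longlonglongrightarrow> \<xi>"
proof -
  obtain m where m: "\<And>x. x \<in> M \<Longrightarrow> \<exists>U F G. local_defining_map m M x U F G"
    using M unfolding embedded_submanifold_def by blast
  then obtain U F G where F: "local_defining_map m M x U F G" using x by blast
  have U: "open U" "x \<in> U" and G: "\<And>i. i < m \<Longrightarrow> continuous_on U (G i)"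
    using F unfolding local_defining_map_def by auto
  have dims: "dim (tangent_space M y) = dim (tangent_space M x)" if y: "y \<in> M" for y
  proof -
    obtain U' F' G' where "local_defining_map m M y U' F' G'" using m[OF y] by blast
    from dim_tangent_space[OF R this y] dim_tangent_space[OF R F x] show ?thesis by linarith
  qed
  show thesis
  proof (rule subspace_limit_approximation[where S = "\<lambda>k. tangent_space M (xs k)"
        and T = "tangent_space M x" and \<xi> = \<xi>])
    fix r :: "nat \<Rightarrow> nat" and v :: "nat \<Rightarrow> 'a" and w
    assume r: "strict_mono r" and v: "\<And>k. v k \<in> tangent_space M (xs (r k))" "v \<longlonglongrightarrow> w"
    have xr: "(\<lambda>k. xs (r k)) \<longlonglongrightarrow> x"
      using LIMSEQ_subseq_LIMSEQ[OF xs(2) r] by (simp add: o_def)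
    then have ev: "\<forall>\<^sub>F k in sequentially. xs (r k) \<in> U" using U topological_tendstoD by blast
    have "inner (G i x) w = 0" if "i < m" for i
    proof (rule LIMSEQ_unique)
      have "isCont (G i) x" using G[OF that] U continuous_on_eq_continuous_at by blast
      then show "(\<lambda>k. inner (G i (xs (r k))) (v k)) \<longlonglongrightarrow> inner (G i x) w"
        using isCont_tendsto_compose[OF _ xr] v(2) tendsto_inner by blast
      show "(\<lambda>k. inner (G i (xs (r k))) (v k)) \<longlonglongrightarrow> 0"
        using ev by (rule tendsto_eventually[OF eventually_mono])
          (use tangent_space_orthogonal_gradients[OF R F] xs(1) v(1) that in blast)
    qed
    then show "w \<in> tangent_space M x" unfolding tangent_space_eq_kernel[OF R F x] by blast
  qed (fact that subspace_tangent_space[OF M R xs(1)] subspace_tangent_space[OF M R x]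
      dims[OF xs(1)] \<xi>)+
qed

text \<open>The definite description has to be justified first. Existence is the orthogonal
  decomposition; for uniqueness, two candidates differ by a vector of \<open>T\<close> that is
  orthogonal to itself.\<close>

lemma orthogonal_projection_properties:
  assumes "subspace T"
  shows "orthogonal_projection T v \<in> T"
    and "t \<in> T \<Longrightarrow> inner (orthogonal_projection T v) t = inner v t"
proof -
  obtain y z where yz: "y \<in> span T" "\<And>w. w \<in> span T \<Longrightarrow> orthogonal z w" "v = y + z"
    using orthogonal_subspace_decomp_exists[of T v] by blast
  have "\<exists>!p. p \<in> T \<and> (\<forall>t\<in>T. orthogonal (v - p) t)"
  proof (rule ex1I[of _ y])
    show "y \<in> T \<and> (\<forall>t\<in>T. orthogonal (v - y) t)"
      using yz assms by (metis add_diff_cancel_left' span_eq_iff)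
    fix p assume p: "p \<in> T \<and> (\<forall>t\<in>T. orthogonal (v - p) t)"
    have yT: "y \<in> T" "p - y \<in> T" using yz(1) p assms by (metis span_eq_iff subspace_diff)+
    then have "orthogonal (v - p) (p - y)" "orthogonal z (p - y)"
      using p yz(2) span_base by blast+
    then have "inner (p - y) (p - y) = 0"
      unfolding orthogonal_def yz(3) by (simp add: algebra_simps inner_commute)
    then show "p = y" by simp
  qed
  from theI'[OF this] show "orthogonal_projection T v \<in> T"
    and "t \<in> T \<Longrightarrow> inner (orthogonal_projection T v) t = inner v t"
    unfolding orthogonal_projection_def orthogonal_def by (auto simp: inner_diff_left)
qed

section \<open>Retractions\<close>

lemma retraction_local_C2:
  assumes "retraction_on_manifold M R" "p \<in> tangent_bundle M"
  obtains W R' D1 D2 where "open W" "p \<in> W" "C2_with_derivs W R' D1 D2"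
    "\<And>q. q \<in> tangent_bundle M \<Longrightarrow> q \<in> W \<Longrightarrow> R q = R' q"
  using assms unfolding retraction_on_manifold_def C2_on_def by blast

lemma continuous_on_retraction:
  assumes R: "retraction_on_manifold M R"
  shows "continuous_on (tangent_bundle M) R"
  unfolding continuous_on_eq_continuous_within
proof
  fix p assume p: "p \<in> tangent_bundle M"
  obtain W R' D1 D2 where W: "open W" "p \<in> W" "C2_with_derivs W R' D1 D2"
    and eq: "\<And>q. q \<in> tangent_bundle M \<Longrightarrow> q \<in> W \<Longrightarrow> R q = R' q"
    using retraction_local_C2[OF R p] by metis
  have "(R' has_derivative blinfun_apply (D1 p)) (at p)"
    using W(2,3) unfolding C2_with_derivs_def by blast
  then have "(R' \<longlongrightarrow> R' p) (at p)" using has_derivative_continuous isCont_def by blast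
  then have "(R' \<longlongrightarrow> R p) (at p within tangent_bundle M)"
    using eq[OF p W(2)] by (simp add: Lim_at_imp_Lim_at_within)
  moreover have "\<forall>\<^sub>F q in at p within tangent_bundle M. R' q = R q"
    unfolding eventually_at_topological by (intro exI[of _ W]) (simp add: W eq)
  ultimately show "continuous (at p within tangent_bundle M) R"
    unfolding continuous_within by (rule Lim_transform_eventually)
qed

lemma zero_in_tangent_space:
  assumes "embedded_submanifold M" "x \<in> M"
  shows "0 \<in> tangent_space M x"
  using assms unfolding embedded_submanifold_def tangent_space_def by fastforce

text \<open>This is the Taylor estimate for a local extension \<open>R'\<close> at
  \<open>(y, 0)\<close> in the direction \<open>(0, \<xi>)\<close>. Compactness of a ball around
  \<open>(x0, 0)\<close> bounds the second derivative, so \<open>K\<close> is uniform in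
  \<open>y\<close>.\<close>

lemma retraction_quadratic_estimate:
  fixes M :: "'a::euclidean_space set"
  assumes M: "embedded_submanifold M" and R: "retraction_on_manifold M R" and x0: "x0 \<in> M"
  obtains K \<sigma> where "K \<ge> 0" "\<sigma> > 0"
    "\<And>y \<xi>. y \<in> M \<Longrightarrow> dist x0 y \<le> \<sigma> \<Longrightarrow> \<xi> \<in> tangent_space M y \<Longrightarrow> norm \<xi> \<le> \<sigma>
       \<Longrightarrow> norm (R (y, \<xi>) - y - \<xi>) \<le> K * (norm \<xi>)\<^sup>2"
proof -
  have "(x0, 0) \<in> tangent_bundle M"
    using x0 zero_in_tangent_space[OF M x0] by (simp add: tangent_bundle_def)
  then obtain W R' D1 D2 where W: "open W" "(x0, 0) \<in> W" and C2: "C2_with_derivs W R' D1 D2"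
    and eq: "\<And>q. q \<in> tangent_bundle M \<Longrightarrow> q \<in> W \<Longrightarrow> R q = R' q"
    using retraction_local_C2[OF R] by metis
  obtain \<tau> where \<tau>: "\<tau> > 0" "cball (x0, 0) \<tau> \<subseteq> W" using W open_contains_cball by blast
  have "continuous_on (cball (x0, 0) \<tau>) D2"
    using C2 \<tau>(2) continuous_on_subset unfolding C2_with_derivs_def by blast
  then have "bounded (D2 ` cball (x0, 0) \<tau>)"
    using compact_imp_bounded compact_continuous_image compact_cball by blast
  then obtain K where K: "\<And>q. q \<in> cball (x0, 0) \<tau> \<Longrightarrow> norm (D2 q) \<le> K"
    unfolding bounded_iff by blast
  show thesis
  proof (rule that)
    have "norm (D2 (x0, 0)) \<le> K" using K \<tau> by simp
    then show "K \<ge> 0" using norm_ge_zero order_trans by blast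
    \<comment> \<open>\<open>\<tau> / 2\<close> serves as \<open>\<sigma>\<close>: the product
      distance is at most the sum of the component distances, so such pairs stay in the ball of
      radius \<open>\<tau>\<close>.\<close>
    show "\<tau> / 2 > 0" using \<tau> by simp
    fix y \<xi> assume y: "y \<in> M" "dist x0 y \<le> \<tau> / 2" and \<xi>: "\<xi> \<in> tangent_space M y" "norm \<xi> \<le> \<tau> / 2"
    have mem: "(y, \<zeta>) \<in> cball (x0, 0) \<tau>" if "norm \<zeta> \<le> \<tau> / 2" for \<zeta>
    proof -
      have "dist (x0, 0) (y, \<zeta>) \<le> dist x0 y + dist 0 \<zeta>"
        unfolding dist_Pair_Pair by (rule sqrt_sum_squares_le_sum) auto
      then show ?thesis using y(2) that by simp
    qed
    have T: "(y, t *\<^sub>R \<xi>) \<in> tangent_bundle M" for t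
      using tangent_space_scaleR[OF \<xi>(1)] y by (simp add: tangent_bundle_def)
    have q0: "(y, 0) \<in> W" using mem[of 0] \<tau> by auto
    have Ry0: "R (y, 0) = y" using R y unfolding retraction_on_manifold_def by simp
    have R'y0: "R' (y, 0) = y" using eq[OF _ q0] T[of 0] Ry0 by simp
    \<comment> \<open>\<open>R'\<close> is tied to \<open>R\<close> only on the tangent bundle, so
      its derivative is identified along \<open>t *\<^sub>R \<xi>\<close> with \<open>y\<close>
      fixed, a line inside the bundle.\<close>
    have D: "D1 (y, 0) (0, \<xi>) = \<xi>"
    proof (rule vector_derivative_unique_at)
      have "((\<lambda>t. (y, t *\<^sub>R \<xi>)) has_derivative (\<lambda>t. (0, t *\<^sub>R \<xi>))) (at 0)"
        by (auto intro!: derivative_eq_intros)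
      moreover have "(R' has_derivative blinfun_apply (D1 (y, 0))) (at (y, 0 *\<^sub>R \<xi>))"
        using C2 q0 unfolding C2_with_derivs_def by simp
      ultimately have "((\<lambda>t. R' (y, t *\<^sub>R \<xi>)) has_derivative (\<lambda>t. D1 (y, 0) (0, t *\<^sub>R \<xi>))) (at 0)"
        by (rule has_derivative_compose)
      moreover have "D1 (y, 0) (0, t *\<^sub>R \<xi>) = t *\<^sub>R D1 (y, 0) (0, \<xi>)" for t
        using blinfun.scaleR_right[of "D1 (y, 0)" t "(0, \<xi>)"] by simp
      ultimately show "((\<lambda>t. R' (y, t *\<^sub>R \<xi>)) has_vector_derivative D1 (y, 0) (0, \<xi>)) (at 0)"
        by (simp add: has_vector_derivative_def)
      have "((\<lambda>t. (y, t *\<^sub>R \<xi>)) \<longlongrightarrow> (y, 0)) (at 0)" by (auto intro!: tendsto_eq_intros)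
      then have "\<forall>\<^sub>F t in at 0. (y, t *\<^sub>R \<xi>) \<in> W" using W(1) q0 topological_tendstoD by blast
      then have "\<forall>\<^sub>F t in at 0. R (y, t *\<^sub>R \<xi>) = R' (y, t *\<^sub>R \<xi>)"
        by eventually_elim (use eq T in blast)
      with retraction_curve(2)[OF R y(1) \<xi>(1)]
      show "((\<lambda>t. R' (y, t *\<^sub>R \<xi>)) has_vector_derivative \<xi>) (at 0)"
        unfolding has_vector_derivative_def
        by (rule has_derivative_transform_eventually) (use Ry0 R'y0 in auto)
    qed
    have "norm (R' (y, \<xi>) - R' (y, 0) - D1 (y, 0) ((y, \<xi>) - (y, 0)))
        \<le> K * (norm ((y, \<xi>) - (y, 0)))\<^sup>2"
      using mem[of \<xi>] mem[of 0] \<xi>(2) \<tau> K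
      by (intro C2_with_derivs_quadratic_bound[OF C2, of "cball (x0, 0) \<tau>"]) auto
    moreover have "R (y, \<xi>) = R' (y, \<xi>)" using eq T[of 1] mem[OF \<xi>(2)] \<tau>(2) by auto
    ultimately show "norm (R (y, \<xi>) - y - \<xi>) \<le> K * (norm \<xi>)\<^sup>2"
      using D R'y0 by (simp add: norm_Pair)
  qed
qed

section \<open>Subdifferentials relative to the manifold\<close>

lemma finite_plus_indicator_iff [simp]:
  "\<bar>ereal a + indicator_function M y\<bar> \<noteq> \<infinity> \<longleftrightarrow> y \<in> M"
  by (simp add: indicator_function_def)

text \<open>The epsilon form of the Liminf condition. At \<open>z = x\<close> it is an equality, so
  the full filter \<open>nhds x\<close> is allowed and the estimate can be composed with curves that
  may return to \<open>x\<close>.\<close>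

lemma frechet_subdifferential_lower_estimate:
  assumes v: "v \<in> frechet_subdifferential (\<lambda>y. ereal (\<phi> y) + indicator_function M y) x"
    and e: "e > 0"
  shows "\<forall>\<^sub>F z in nhds x. z \<in> M \<longrightarrow> \<phi> x + inner v (z - x) - e * norm (z - x) \<le> \<phi> z"
proof -
  let ?g = "\<lambda>y. ereal (\<phi> y) + indicator_function M y"
  have x: "x \<in> M" and "0 \<le> Liminf (at x) (\<lambda>y. (?g y - ?g x - ereal (inner v (y - x))) / ereal (norm (y - x)))"
    using v unfolding frechet_subdifferential_def by auto
  then have "ereal (- e) < Liminf (at x) (\<lambda>y. (?g y - ?g x - ereal (inner v (y - x))) / ereal (norm (y - x)))"
    using e by (smt (verit) ereal_less(2) less_le_trans zero_ereal_def ereal_less_eq(3) less_ereal.simps(1))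
  then have "\<forall>\<^sub>F y in at x. ereal (- e) < (?g y - ?g x - ereal (inner v (y - x))) / ereal (norm (y - x))"
    by (rule less_LiminfD)
  then have "\<forall>\<^sub>F z in at x. z \<in> M \<longrightarrow> \<phi> x + inner v (z - x) - e * norm (z - x) \<le> \<phi> z"
    using eventually_neq_at_within[of x x UNIV]
  proof eventually_elim
    case (elim z)
    show ?case
    proof
      assume z: "z \<in> M"
      have n: "norm (z - x) > 0" using elim(2) by simp
      then have "- e < (\<phi> z - \<phi> x - inner v (z - x)) / norm (z - x)"
        using elim(1) z x by (simp add: indicator_function_def)
      then show "\<phi> x + inner v (z - x) - e * norm (z - x) \<le> \<phi> z"
        using n by (simp add: field_simps)
    qed
  qed
  then show ?thesis
    unfolding eventually_at_filter by eventually_elim auto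
qed

text \<open>On \<open>M\<close> near \<open>x\<close>, \<open>\<phi>\<close> lies between the lower
  estimate for \<open>v\<close> and the majorant. Dividing by \<open>t\<close> along a retraction
  curve gives \<open>inner v \<zeta> \<le> D \<zeta>\<close> in the limit;
  \<open>\<zeta> = \<xi>\<close> and \<open>\<zeta> = -\<xi>\<close> together give equality.\<close>

lemma frechet_subdifferential_tangential:
  fixes D :: "'a::euclidean_space \<Rightarrow>\<^sub>L real"
  assumes R: "retraction_on_manifold M R" and x: "x \<in> M" and \<xi>: "\<xi> \<in> tangent_space M x"
    and v: "v \<in> frechet_subdifferential (\<lambda>y. ereal (\<phi> y) + indicator_function M y) x"
    and maj: "\<forall>\<^sub>F z in nhds x. \<phi> z \<le> \<phi> x + D (z - x) + L * (norm (z - x))\<^sup>2"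
  shows "D \<xi> = inner v \<xi>"
proof -
  have ge: "inner v \<zeta> \<le> D \<zeta>" if \<zeta>: "\<zeta> \<in> tangent_space M x" for \<zeta>
  proof (rule field_le_epsilon)
    fix e' :: real assume e': "e' > 0"
    define e where "e = e' / (norm \<zeta> + 1)"
    have e: "e > 0" using e' by (simp add: e_def add_nonneg_pos)
    have e_le: "e * norm \<zeta> \<le> e'"
      using e' by (simp add: e_def divide_simps add_nonneg_pos mult_left_mono)
    let ?z = "\<lambda>t. R (x, t *\<^sub>R \<zeta>)"
    have z0: "?z 0 = x" using R x unfolding retraction_on_manifold_def by simp
    have zM: "?z t \<in> M" and dz: "(?z has_vector_derivative \<zeta>) (at 0)" for t
      using retraction_curve[OF R x \<zeta>] by auto
    have zx: "(?z \<longlongrightarrow> x) (at_right 0)"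
      using has_vector_derivative_continuous[OF dz] z0 unfolding isCont_def
      by (simp add: filterlim_at_split)
    let ?q = "\<lambda>t. (1 / t) *\<^sub>R (?z t - x)"
    have q: "(?q \<longlongrightarrow> \<zeta>) (at_right 0)"
    proof (rule Lim_transform_eventually)
      have "((\<lambda>t. (1 / norm (t - 0)) *\<^sub>R (?z t - (?z 0 + (t - 0) *\<^sub>R \<zeta>))) \<longlongrightarrow> 0) (at_right 0)"
        using has_vector_derivative_at_within[OF dz, of "{0<..}"]
        unfolding has_vector_derivative_def has_derivative_within by blast
      then show "((\<lambda>t. (1 / norm (t - 0)) *\<^sub>R (?z t - (?z 0 + (t - 0) *\<^sub>R \<zeta>)) + \<zeta>) \<longlongrightarrow> \<zeta>) (at_right 0)"
        by (auto intro: tendsto_eq_intros)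
      show "\<forall>\<^sub>F t in at_right 0. (1 / norm (t - 0)) *\<^sub>R (?z t - (?z 0 + (t - 0) *\<^sub>R \<zeta>)) + \<zeta> = ?q t"
        using eventually_at_right_less[of "0::real"]
        by eventually_elim (unfold z0, simp add: algebra_simps)
    qed
    \<comment> \<open>After division by \<open>t\<close>, the quadratic term is a convergent
      quotient times \<open>norm (?z t - x)\<close> and disappears in the limit.\<close>
    have "\<forall>\<^sub>F t in at_right 0. inner v (?q t) - e * norm (?q t)
        \<le> D (?q t) + L * (norm (?q t) * norm (?z t - x))"
      using zx[THEN filterlim_iff[THEN iffD1], rule_format, OF frechet_subdifferential_lower_estimate[OF v e]]
        zx[THEN filterlim_iff[THEN iffD1], rule_format, OF maj] eventually_at_right_less
    proof eventually_elim
      case (elim t)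
      define d where "d = ?z t - x"
      have "inner v d - e * norm d \<le> D d + L * (norm d)\<^sup>2" using elim(1,2) zM[of t] unfolding d_def by fastforce
      then have "(1 / t) * (inner v d - e * norm d) \<le> (1 / t) * (D d + L * (norm d)\<^sup>2)"
        using elim(3) by (intro mult_left_mono) auto
      then show ?case using elim(3)
        unfolding d_def[symmetric] by (simp add: blinfun.scaleR_right power2_eq_square algebra_simps)
    qed
    moreover have "((\<lambda>t. inner v (?q t) - e * norm (?q t)) \<longlongrightarrow> inner v \<zeta> - e * norm \<zeta>) (at_right 0)"
      by (intro tendsto_intros q)
    moreover have "((\<lambda>t. D (?q t) + L * (norm (?q t) * norm (?z t - x)))
        \<longlongrightarrow> D \<zeta> + L * (norm \<zeta> * norm (x - x))) (at_right 0)"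
      by (intro tendsto_intros q zx)
    ultimately have "inner v \<zeta> - e * norm \<zeta> \<le> D \<zeta> + L * (norm \<zeta> * norm (x - x))"
      by (intro tendsto_le[OF _ _ _]) auto
    then show "inner v \<zeta> \<le> D \<zeta> + e'" using e_le by simp
  qed
  show ?thesis
    using ge[OF \<xi>] ge[OF tangent_space_scaleR[OF \<xi>, of "-1"]]
    by (simp add: blinfun.minus_right)
qed

text \<open>\<open>D\<close> is exchanged for \<open>v\<close> only on the tangent vector
  \<open>\<xi>\<close>. The error terms involve \<open>D\<close> through
  \<open>norm D \<le> L\<close> alone, so \<open>\<kappa>\<close> is uniform over all subgradients
  \<open>v\<close>.\<close>

lemma frechet_subdifferential_retraction_estimate:
  fixes M U :: "'a::euclidean_space set" and \<phi> :: "'a \<Rightarrow> real"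
  assumes M: "embedded_submanifold M" and R: "retraction_on_manifold M R"
    and \<phi>: "upper_C2_on TYPE('c) U \<phi>" and x0: "x0 \<in> M" "x0 \<in> U"
  obtains \<rho> \<kappa> \<delta> where "continuous_on (cball x0 \<rho>) \<phi>" "\<kappa> > 0" "\<delta> > 0"
    "\<And>y \<xi>. y \<in> M \<Longrightarrow> dist x0 y < \<delta> \<Longrightarrow> \<xi> \<in> tangent_space M y \<Longrightarrow> norm \<xi> < \<delta> \<Longrightarrow> R (y, \<xi>) \<in> ball x0 \<rho>"
    "\<And>y \<xi> v. y \<in> M \<Longrightarrow> dist x0 y < \<delta> \<Longrightarrow> \<xi> \<in> tangent_space M y \<Longrightarrow> norm \<xi> < \<delta> \<Longrightarrow>
       v \<in> frechet_subdifferential (\<lambda>y. ereal (\<phi> y) + indicator_function M y) y \<Longrightarrow>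
       \<phi> (R (y, \<xi>)) \<le> \<phi> y + inner v \<xi> + \<kappa> * (norm \<xi>)\<^sup>2"
proof -
  obtain \<rho> L where \<rho>: "\<rho> > 0" and L: "L \<ge> 0"
    and maj: "\<And>y. y \<in> cball x0 \<rho> \<Longrightarrow> \<exists>D. norm D \<le> L \<and>
        (\<forall>z\<in>cball x0 \<rho>. \<phi> z \<le> \<phi> y + blinfun_apply D (z - y) + L * (norm (z - y))\<^sup>2)"
    using upper_C2_on_quadratic_majorant[OF \<phi> x0(2)] by metis
  obtain K \<sigma> where K: "K \<ge> 0" and \<sigma>: "\<sigma> > 0"
    and quad: "\<And>y \<xi>. y \<in> M \<Longrightarrow> dist x0 y \<le> \<sigma> \<Longrightarrow> \<xi> \<in> tangent_space M y \<Longrightarrow> norm \<xi> \<le> \<sigma>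
       \<Longrightarrow> norm (R (y, \<xi>) - y - \<xi>) \<le> K * (norm \<xi>)\<^sup>2"
    using retraction_quadratic_estimate[OF M R x0(1)] by metis
  \<comment> \<open>\<open>\<sigma>\<close> admits the retraction estimate, 1 gives
    \<open>(norm \<xi>)\<^sup>2 \<le> norm \<xi>\<close>, and the last term bounds both
    \<open>dist x0 y\<close> and the displacement by \<open>\<rho> / 4\<close>.\<close>
  define \<delta> where "\<delta> = min (min \<sigma> 1) (\<rho> / (4 * (1 + K)))"
  \<comment> \<open>\<open>L * K\<close> comes from \<open>D\<close> on the retraction error,
    \<open>L * (1 + K)\<^sup>2\<close> from the quadratic term of the majorant; the 1 secures
    positivity.\<close>
  define \<kappa> where "\<kappa> = L * K + L * (1 + K)\<^sup>2 + 1"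
  have \<delta>: "\<delta> > 0" "\<delta> \<le> \<sigma>" "\<delta> \<le> 1" using \<sigma> \<rho> K by (auto simp: \<delta>_def)
  have "\<delta> \<le> \<rho> / (4 * (1 + K))" by (simp add: \<delta>_def)
  then have \<delta>K: "(1 + K) * \<delta> \<le> \<rho> / 4" using K by (simp add: field_simps)
  then have \<delta>\<rho>: "\<delta> \<le> \<rho> / 4" using mult_nonneg_nonneg[OF K, of \<delta>] \<delta>(1) by (simp add: algebra_simps)
  have step: "norm (R (y, \<xi>) - y - \<xi>) \<le> K * (norm \<xi>)\<^sup>2" "norm (R (y, \<xi>) - y) \<le> (1 + K) * norm \<xi>"
    "R (y, \<xi>) \<in> ball x0 \<rho>"
    if y: "y \<in> M" "dist x0 y < \<delta>" and \<xi>: "\<xi> \<in> tangent_space M y" "norm \<xi> < \<delta>" for y \<xi>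
  proof -
    show a: "norm (R (y, \<xi>) - y - \<xi>) \<le> K * (norm \<xi>)\<^sup>2"
      using quad[of y \<xi>] y \<xi> \<delta> by simp
    have "(norm \<xi>)\<^sup>2 \<le> norm \<xi>"
      using \<xi>(2) \<delta>(3) mult_left_le[of "norm \<xi>" "norm \<xi>"] by (simp add: power2_eq_square)
    then have "K * (norm \<xi>)\<^sup>2 \<le> K * norm \<xi>" using K by (rule mult_left_mono)
    then show b: "norm (R (y, \<xi>) - y) \<le> (1 + K) * norm \<xi>"
      using a norm_triangle_ineq[of "R (y, \<xi>) - y - \<xi>" \<xi>] by (simp add: algebra_simps)
    have "(1 + K) * norm \<xi> \<le> (1 + K) * \<delta>" using K \<xi>(2) by (intro mult_left_mono) auto
    then have "dist y (R (y, \<xi>)) \<le> \<rho> / 4"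
      using b \<delta>K by (simp add: dist_norm norm_minus_commute)
    then show "R (y, \<xi>) \<in> ball x0 \<rho>"
      using dist_triangle[of x0 "R (y, \<xi>)" y] y(2) \<delta>\<rho> \<rho> by simp
  qed
  show thesis
  proof (rule that[of \<rho> \<kappa> \<delta>])
    show "continuous_on (cball x0 \<rho>) \<phi>"
      using quadratic_majorant_imp_continuous_on[OF L maj] .
    show "\<kappa> > 0" using L K by (simp add: \<kappa>_def add_nonneg_pos)
    fix y \<xi> v assume y: "y \<in> M" "dist x0 y < \<delta>" and \<xi>: "\<xi> \<in> tangent_space M y" "norm \<xi> < \<delta>"
      and v: "v \<in> frechet_subdifferential (\<lambda>y. ereal (\<phi> y) + indicator_function M y) y"
    have y\<rho>: "y \<in> ball x0 \<rho>" using y(2) \<delta>\<rho> \<rho> by simp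
    then obtain D where D: "norm D \<le> L"
      and up: "\<And>z. z \<in> cball x0 \<rho> \<Longrightarrow> \<phi> z \<le> \<phi> y + blinfun_apply D (z - y) + L * (norm (z - y))\<^sup>2"
      using maj[of y] by auto
    have "\<forall>\<^sub>F z in nhds y. z \<in> ball x0 \<rho>" using y\<rho> eventually_nhds_in_open open_ball by blast
    then have "\<forall>\<^sub>F z in nhds y. \<phi> z \<le> \<phi> y + D (z - y) + L * (norm (z - y))\<^sup>2"
      by eventually_elim (use up in auto)
    then have D\<xi>: "D \<xi> = inner v \<xi>"
      using frechet_subdifferential_tangential[OF R y(1) \<xi>(1) v] by blast
    let ?z = "R (y, \<xi>)"
    have "D (?z - y) = D \<xi> + D (?z - y - \<xi>)" by (simp add: blinfun.diff_right)
    moreover have "D (?z - y - \<xi>) \<le> L * (K * (norm \<xi>)\<^sup>2)"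
    proof -
      have "D (?z - y - \<xi>) \<le> norm D * norm (?z - y - \<xi>)"
        using norm_blinfun[of D "?z - y - \<xi>"] by simp
      also have "\<dots> \<le> L * (K * (norm \<xi>)\<^sup>2)"
        using D step(1)[OF y \<xi>] L by (intro mult_mono) auto
      finally show ?thesis .
    qed
    moreover have "L * (norm (?z - y))\<^sup>2 \<le> L * ((1 + K) * norm \<xi>)\<^sup>2"
      using step(2)[OF y \<xi>] L by (intro mult_left_mono power_mono) auto
    moreover have "?z \<in> cball x0 \<rho>" using step(3)[OF y \<xi>] by simp
    ultimately have "\<phi> ?z \<le> \<phi> y + inner v \<xi> + (L * (K * (norm \<xi>)\<^sup>2) + L * ((1 + K) * norm \<xi>)\<^sup>2)"
      using up[of ?z] D\<xi> by linarith
    also have "\<dots> \<le> \<phi> y + inner v \<xi> + \<kappa> * (norm \<xi>)\<^sup>2"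
      unfolding \<kappa>_def power_mult_distrib by (simp add: distrib_right mult.assoc)
    finally show "\<phi> ?z \<le> \<phi> y + inner v \<xi> + \<kappa> * (norm \<xi>)\<^sup>2" .
  qed (use \<delta> step(3) in auto)
qed

text \<open>The Frechet estimate at nearby points passes to the limit by continuity of
  \<open>\<phi>\<close> and \<open>R\<close>. The bound \<open>B\<close> is recorded with the same
  \<open>\<delta>\<close> because local boundedness combines both estimates.\<close>

lemma proj_subdifferential_retraction_estimate:
  fixes M U :: "'a::euclidean_space set" and \<phi> :: "'a \<Rightarrow> real"
  assumes M: "embedded_submanifold M" and R: "retraction_on_manifold M R"
    and \<phi>: "upper_C2_on TYPE('c) U \<phi>" and x0: "x0 \<in> M" "x0 \<in> U"
  obtains B \<kappa> \<delta> where "\<kappa> > 0" "\<delta> > 0"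
    "\<And>x \<xi>. x \<in> M \<Longrightarrow> dist x0 x < \<delta> \<Longrightarrow> \<xi> \<in> tangent_space M x \<Longrightarrow> norm \<xi> < \<delta> \<Longrightarrow> \<bar>\<phi> (R (x, \<xi>))\<bar> \<le> B"
    "\<And>x \<xi> w. x \<in> M \<Longrightarrow> dist x0 x < \<delta> \<Longrightarrow> \<xi> \<in> tangent_space M x \<Longrightarrow> norm \<xi> < \<delta> \<Longrightarrow>
       w \<in> proj_subdifferential M \<phi> x \<Longrightarrow> \<phi> (R (x, \<xi>)) \<le> \<phi> x + inner w \<xi> + \<kappa> * (norm \<xi>)\<^sup>2"
proof -
  let ?g = "\<lambda>y. ereal (\<phi> y) + indicator_function M y"
  obtain \<rho> \<kappa> \<delta> where cont: "continuous_on (cball x0 \<rho>) \<phi>" and "\<kappa> > 0" "\<delta> > 0"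
    and ball: "\<And>y \<xi>. y \<in> M \<Longrightarrow> dist x0 y < \<delta> \<Longrightarrow> \<xi> \<in> tangent_space M y \<Longrightarrow> norm \<xi> < \<delta> \<Longrightarrow>
      R (y, \<xi>) \<in> ball x0 \<rho>"
    and est: "\<And>y \<xi> v. y \<in> M \<Longrightarrow> dist x0 y < \<delta> \<Longrightarrow> \<xi> \<in> tangent_space M y \<Longrightarrow> norm \<xi> < \<delta> \<Longrightarrow>
      v \<in> frechet_subdifferential ?g y \<Longrightarrow> \<phi> (R (y, \<xi>)) \<le> \<phi> y + inner v \<xi> + \<kappa> * (norm \<xi>)\<^sup>2"
    by (rule frechet_subdifferential_retraction_estimate[OF M R \<phi> x0], rule that) assumption+
  have "bounded (\<phi> ` cball x0 \<rho>)"
    using cont compact_imp_bounded compact_continuous_image compact_cball by blast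
  then obtain B where "\<forall>t\<in>\<phi> ` cball x0 \<rho>. norm t \<le> B" unfolding bounded_iff by blast
  then have B: "\<bar>\<phi> z\<bar> \<le> B" if "z \<in> cball x0 \<rho>" for z using that by force
  have \<phi>_lim: "(\<lambda>k. \<phi> (zs k)) \<longlonglongrightarrow> \<phi> z" if "zs \<longlonglongrightarrow> z" "z \<in> ball x0 \<rho>" for zs :: "nat \<Rightarrow> 'a" and z
  proof -
    have "isCont \<phi> z"
      using cont that(2) continuous_on_interior[of "cball x0 \<rho>" \<phi> z] by simp
    then show ?thesis using isCont_tendsto_compose that(1) by blast
  qed
  show thesis
  proof (rule that[of \<kappa> \<delta> B])
    fix x \<xi> assume x: "x \<in> M" "dist x0 x < \<delta>" and \<xi>: "\<xi> \<in> tangent_space M x" "norm \<xi> < \<delta>"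
    then show "\<bar>\<phi> (R (x, \<xi>))\<bar> \<le> B" using ball[OF x \<xi>] B by simp
    fix w assume "w \<in> proj_subdifferential M \<phi> x"
    then obtain v where w: "w = orthogonal_projection (tangent_space M x) v"
      and "v \<in> limiting_subdifferential ?g x"
      unfolding proj_subdifferential_def by blast
    then obtain xs vs where xs: "xs \<longlonglongrightarrow> x" and vs: "vs \<longlonglongrightarrow> v"
      and fr: "\<And>k. vs k \<in> frechet_subdifferential ?g (xs k)"
      unfolding limiting_subdifferential_def by blast
    have xsM: "xs k \<in> M" for k using fr[of k] unfolding frechet_subdifferential_def by simp
    \<comment> \<open>\<open>\<xi>\<close> may fail to be tangent at the approximating points, so
      tangent vectors \<open>\<eta> k\<close> converging to it take its place.\<close>
    obtain r \<eta> where r: "strict_mono r" and \<eta>: "\<And>k. \<eta> k \<in> tangent_space M (xs (r k))" "\<eta> \<longlonglongrightarrow> \<xi>"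
      using tangent_space_limit_approximation[OF M R xsM xs x(1) \<xi>(1)] by metis
    have xr: "(\<lambda>k. xs (r k)) \<longlonglongrightarrow> x" and vr: "(\<lambda>k. vs (r k)) \<longlonglongrightarrow> v"
      using LIMSEQ_subseq_LIMSEQ[OF xs r] LIMSEQ_subseq_LIMSEQ[OF vs r] by (simp_all add: o_def)
    have T: "(y, \<zeta>) \<in> tangent_bundle M" if "y \<in> M" "\<zeta> \<in> tangent_space M y" for y \<zeta>
      using that by (simp add: tangent_bundle_def)
    have Rr: "(\<lambda>k. R (xs (r k), \<eta> k)) \<longlonglongrightarrow> R (x, \<xi>)"
      by (rule continuous_on_tendsto_compose[OF continuous_on_retraction[OF R]])
        (use T x \<xi> xsM \<eta> in \<open>auto intro!: tendsto_Pair xr\<close>)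
    have "\<phi> (R (x, \<xi>)) \<le> \<phi> x + inner v \<xi> + \<kappa> * (norm \<xi>)\<^sup>2"
    proof (rule tendsto_le[OF _ _ \<phi>_lim[OF Rr ball[OF x \<xi>]]])
      have "x \<in> ball x0 \<rho>"
        using ball[OF x zero_in_tangent_space[OF M x(1)]] \<open>\<delta> > 0\<close> R x(1)
        unfolding retraction_on_manifold_def by simp
      then show "(\<lambda>k. \<phi> (xs (r k)) + inner (vs (r k)) (\<eta> k) + \<kappa> * (norm (\<eta> k))\<^sup>2)
          \<longlonglongrightarrow> \<phi> x + inner v \<xi> + \<kappa> * (norm \<xi>)\<^sup>2"
        by (intro tendsto_intros \<phi>_lim xr vr \<eta>)
      have "\<forall>\<^sub>F k in sequentially. dist x0 (xs (r k)) < \<delta>"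
        by (rule order_tendstoD(2)[OF _ x(2)]) (intro tendsto_intros xr)
      moreover have "\<forall>\<^sub>F k in sequentially. norm (\<eta> k) < \<delta>"
        by (rule order_tendstoD(2)[OF _ \<xi>(2)]) (intro tendsto_intros \<eta>)
      ultimately show "\<forall>\<^sub>F k in sequentially. \<phi> (R (xs (r k), \<eta> k))
          \<le> \<phi> (xs (r k)) + inner (vs (r k)) (\<eta> k) + \<kappa> * (norm (\<eta> k))\<^sup>2"
        by eventually_elim (use est xsM \<eta>(1) fr in blast)
    qed simp
    \<comment> \<open>Projection leaves inner products with tangent vectors unchanged, so
      \<open>v\<close> can be replaced by \<open>w\<close>.\<close>
    then show "\<phi> (R (x, \<xi>)) \<le> \<phi> x + inner w \<xi> + \<kappa> * (norm \<xi>)\<^sup>2"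
      using orthogonal_projection_properties(2)[OF subspace_tangent_space[OF M R x(1)] \<xi>(1)] w by simp
  qed (use \<open>\<kappa> > 0\<close> \<open>\<delta> > 0\<close> in auto)
qed

section \<open>Uniform estimate and local boundedness of the projectional subdifferential\<close>

theorem lemma2p12:
  fixes M U :: "'a::euclidean_space set"
    and \<phi> :: "'a \<Rightarrow> real"
    and R :: "'a \<times> 'a \<Rightarrow> 'a"
  assumes "embedded_submanifold M"
    and "open U" and "M \<subseteq> U"
    and "upper_C2_on TYPE('c) U \<phi>"
    and "retraction_on_manifold M R"
  shows "(\<forall>x0\<in>M. \<exists>\<kappa>>0. \<exists>r>0. \<exists>V. openin (top_of_set M) V \<and> x0 \<in> V \<and>
            (\<forall>x\<in>V. \<forall>\<xi>\<in>tangent_space M x. norm \<xi> \<le> r \<longrightarrow>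
               (\<forall>w\<in>proj_subdifferential M \<phi> x.
                  \<phi> (R (x, \<xi>)) - (\<phi> x + inner w \<xi>) \<le> \<kappa> * (norm \<xi>)\<^sup>2)))
         \<and> locally_bounded_on M (proj_subdifferential M \<phi>)"
proof (intro conjI ballI, unfold locally_bounded_on_def, goal_cases)
  case (1 x0)
  with assms(3) have "x0 \<in> U" by blast
  from proj_subdifferential_retraction_estimate[OF assms(1,5,4) 1 this]
  obtain \<kappa> \<delta> where \<kappa>: "\<kappa> > 0" and \<delta>: "\<delta> > 0" and
    est: "\<And>x \<xi> w. x \<in> M \<Longrightarrow> dist x0 x < \<delta> \<Longrightarrow> \<xi> \<in> tangent_space M x \<Longrightarrow> norm \<xi> < \<delta> \<Longrightarrow>
       w \<in> proj_subdifferential M \<phi> x \<Longrightarrow> \<phi> (R (x, \<xi>)) \<le> \<phi> x + inner w \<xi> + \<kappa> * (norm \<xi>)\<^sup>2"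
    by metis
  have "openin (top_of_set M) (M \<inter> ball x0 \<delta>)" by (simp add: openin_open_Int)
  moreover have "x0 \<in> M \<inter> ball x0 \<delta>" using 1 \<delta> by simp
  \<comment> \<open>Halving \<open>\<delta>\<close> accommodates the non-strict condition on
    \<open>norm \<xi>\<close>.\<close>
  moreover have "\<phi> (R (x, \<xi>)) - (\<phi> x + inner w \<xi>) \<le> \<kappa> * (norm \<xi>)\<^sup>2"
    if "x \<in> M \<inter> ball x0 \<delta>" "\<xi> \<in> tangent_space M x" "norm \<xi> \<le> \<delta> / 2" "w \<in> proj_subdifferential M \<phi> x"
    for x \<xi> w
    using est[of x \<xi> w] that \<delta> by simp
  ultimately show ?case using \<kappa> half_gt_zero[OF \<delta>] by blast
next
  case 2
  show ?case
  proof
    fix x0 assume x0: "x0 \<in> M"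
    with assms(3) have "x0 \<in> U" by blast
    from proj_subdifferential_retraction_estimate[OF assms(1,5,4) x0 this]
    obtain B \<kappa> \<delta> where \<kappa>: "\<kappa> > 0" and \<delta>: "\<delta> > 0" and
      B: "\<And>x \<xi>. x \<in> M \<Longrightarrow> dist x0 x < \<delta> \<Longrightarrow> \<xi> \<in> tangent_space M x \<Longrightarrow> norm \<xi> < \<delta> \<Longrightarrow> \<bar>\<phi> (R (x, \<xi>))\<bar> \<le> B" and
      est: "\<And>x \<xi> w. x \<in> M \<Longrightarrow> dist x0 x < \<delta> \<Longrightarrow> \<xi> \<in> tangent_space M x \<Longrightarrow> norm \<xi> < \<delta> \<Longrightarrow>
         w \<in> proj_subdifferential M \<phi> x \<Longrightarrow> \<phi> (R (x, \<xi>)) \<le> \<phi> x + inner w \<xi> + \<kappa> * (norm \<xi>)\<^sup>2"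
      by metis
    let ?r = "\<delta> / 2"
    have r: "?r > 0" "?r < \<delta>" using \<delta> by auto
    \<comment> \<open>For nonzero \<open>w\<close> the estimate reads
      \<open>- B \<le> B - ?r * norm w + \<kappa> * ?r\<^sup>2\<close>, with one \<open>B\<close>
      for each of the two values of \<open>\<phi>\<close>; solving for \<open>norm w\<close> gives
      this bound.\<close>
    have "norm w \<le> (2 * B + \<kappa> * ?r\<^sup>2) / ?r"
      if x: "x \<in> M" "dist x0 x < \<delta>" and w: "w \<in> proj_subdifferential M \<phi> x" for x w
    proof -
      have wT: "w \<in> tangent_space M x"
        using w orthogonal_projection_properties(1)[OF subspace_tangent_space[OF assms(1,5) x(1)]]
        unfolding proj_subdifferential_def by blast
      let ?\<xi> = "(- ?r) *\<^sub>R sgn w"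
      have T: "?\<xi> \<in> tangent_space M x" "0 \<in> tangent_space M x"
        using tangent_space_scaleR[OF wT, of "- ?r * inverse (norm w)"]
          tangent_space_scaleR[OF wT, of 0] by (simp_all add: sgn_div_norm)
      have n: "norm ?\<xi> \<le> ?r" using r by (simp add: norm_sgn)
      have \<phi>x: "\<bar>\<phi> x\<bar> \<le> B"
        using B[OF x T(2)] \<delta> assms(5) x(1) unfolding retraction_on_manifold_def by simp
      show ?thesis
      proof (cases "w = 0")
        case False
        have "inner w (sgn w) = norm w"
          using False by (simp add: sgn_div_norm dot_square_norm power2_eq_square)
        then have "inner w ?\<xi> = - ?r * norm w" by simp
        moreover have "norm ?\<xi> = ?r" using r False by (simp add: norm_sgn)
        ultimately have "?r * norm w \<le> 2 * B + \<kappa> * ?r\<^sup>2"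
          using est[OF x T(1) _ w] B[OF x T(1)] \<phi>x r by simp
        then show ?thesis using r by (simp add: field_simps)
      next
        case True
        \<comment> \<open>Here \<open>sgn w\<close> is 0, so the test vector carries no information;
          the bound holds because \<open>B \<ge> 0\<close> by \<open>\<phi>x\<close>.\<close>
        then show ?thesis using \<phi>x \<kappa> r by simp
      qed
    qed
    then have "bounded (\<Union>x\<in>M \<inter> ball x0 \<delta>. proj_subdifferential M \<phi> x)"
      unfolding bounded_iff by (intro exI[of _ "(2 * B + \<kappa> * ?r\<^sup>2) / ?r"]) auto
    moreover have "openin (top_of_set M) (M \<inter> ball x0 \<delta>)" by (simp add: openin_open_Int)
    moreover have "x0 \<in> M \<inter> ball x0 \<delta>" using x0 \<delta> by simp
    ultimately show "\<exists>V. openin (top_of_set M) V \<and> x0 \<in> V \<and> bounded (\<Union>x\<in>V. proj_subdifferential M \<phi> x)"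
      by blast
  qed
qed

end
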